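(* In the $L^\infty$ norm on $\mathbb{R}^2$, for every positive integer $n\leq 8$ there exists a strong crescent configuration of size $n$.
   Context: Let $\|\cdot\|$ be the $L^\infty$ norm on $\mathbb{R}^2$, $\|(x,y)\|=\max\{|x|,|y|\}$. A $\|\cdot\|$ circle is a set $\{q\in\mathbb{R}^2:\|q-p\|=r\}$ with $p\in\mathbb{R}^2$, $r>0$. A set $S\subset\mathbb{R}^2$ of $n$ points is a line-like configuration of size $n$ in $\|\cdot\|$ if its distance graph is isomorphic to that of $n$ equally spaced points on a line, i.e. there is a bijection $\phi: S\to\{1,\dots,n\}$ such that for all $a,b,c,d\in S$: $\|a-b\|=\|c-d\|$ if and only if $|\phi(a)-\phi(b)|=|\phi(c)-\phi(d)|$. A set of points lies in strong general position in $\|\cdot\|$ if (1) no three of its points lie on a common line, (2) no four of its points lie on a common $\|\cdot\|$ circle, and (3) no four of its points form a line-like configuration of size four in $\|\cdot\|$. A set of $n$ points in $\mathbb{R}^2$ is a strong crescent configuration of size $n$ in $\|\cdot\|$ if (1) it lies in strong general position in $\|\cdot\|$, (2) it determines exactly $n-1$ distinct (nonzero) distances, measured in $\|\cdot\|$, and (3) for each $1\leq i\leq n-1$ there is a distance which occurs with multiplicity exactly $i$ among the unordered pairs of distinct points. *)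

theory Defs
  imports "HOL-Analysis.Analysis"
begin

text \<open>The notions below are relative to a norm \<open>N\<close> on the plane. The \<open>L\<^sup>\<infinity>\<close> norm is the
  library constant \<^const>\<open>infnorm\<close>; on pairs it is the usual maximum:\<close>

lemma infnorm_Pair: "infnorm (x, y) = max \<bar>x\<bar> \<bar>y\<bar>" for x y :: real
proof -
  have Basis: "(Basis :: (real \<times> real) set) = {(1, 0), (0, 1)}"
    by (auto simp: Basis_prod_def)
  show ?thesis
    unfolding infnorm_Max Basis by (simp add: max.commute)
qed

definition norm_circle ::
  "(real \<times> real \<Rightarrow> real) \<Rightarrow> real \<times> real \<Rightarrow> real \<Rightarrow> (real \<times> real) set" where
  "norm_circle N p r = {q. N (q - p) = r}"

definition line_like_configuration ::
  "(real \<times> real \<Rightarrow> real) \<Rightarrow> nat \<Rightarrow> (real \<times> real) set \<Rightarrow> bool" where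
  "line_like_configuration N n S \<longleftrightarrow>
     (\<exists>\<phi> :: real \<times> real \<Rightarrow> nat. bij_betw \<phi> S {1..n} \<and>
        (\<forall>a\<in>S. \<forall>b\<in>S. \<forall>c\<in>S. \<forall>d\<in>S.
           N (a - b) = N (c - d) \<longleftrightarrow>
           \<bar>int (\<phi> a) - int (\<phi> b)\<bar> = \<bar>int (\<phi> c) - int (\<phi> d)\<bar>))"

definition strong_general_position ::
  "(real \<times> real \<Rightarrow> real) \<Rightarrow> (real \<times> real) set \<Rightarrow> bool" where
  "strong_general_position N S \<longleftrightarrow>
     (\<forall>T\<subseteq>S. card T = 3 \<longrightarrow> \<not> collinear T) \<and>
     (\<forall>T\<subseteq>S. card T = 4 \<longrightarrow> \<not> (\<exists>p r. r > 0 \<and> T \<subseteq> norm_circle N p r)) \<and>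
     (\<forall>T\<subseteq>S. card T = 4 \<longrightarrow> \<not> line_like_configuration N 4 T)"

definition distances ::
  "(real \<times> real \<Rightarrow> real) \<Rightarrow> (real \<times> real) set \<Rightarrow> real set" where
  "distances N S = {N (a - b) | a b. a \<in> S \<and> b \<in> S \<and> a \<noteq> b}"

definition multiplicity_of_distance ::
  "(real \<times> real \<Rightarrow> real) \<Rightarrow> (real \<times> real) set \<Rightarrow> real \<Rightarrow> nat" where
  "multiplicity_of_distance N S d =
     card {{a, b} | a b. a \<in> S \<and> b \<in> S \<and> a \<noteq> b \<and> N (a - b) = d}"

definition strong_crescent_configuration ::
  "(real \<times> real \<Rightarrow> real) \<Rightarrow> nat \<Rightarrow> (real \<times> real) set \<Rightarrow> bool" where
  "strong_crescent_configuration N n S \<longleftrightarrow>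
     finite S \<and> card S = n \<and>
     strong_general_position N S \<and>
     card (distances N S) = n - 1 \<and>
     (\<forall>i. 1 \<le> i \<and> i \<le> n - 1 \<longrightarrow>
        (\<exists>d\<in>distances N S. multiplicity_of_distance N S d = i))"

end

theory Submission
  imports Defs
begin

text \<open>Configurations with integer coordinates suffice; they were found by a randomised computer
  search. For a list of integer points every clause of the definition becomes a decidable integer
  condition. The only clause that quantifies over reals concerns circles, and there the extreme
  coordinates of the points decide: a point on a side of a square that contains the whole set
  is extreme in the set, and if the set meets two opposite sides, the distance of these sides is
  determined and bounds the extent of the set in the other direction.\<close>

section \<open>Integer encoding of the configuration conditions\<close>

definition real_point :: "int \<times> int \<Rightarrow> real \<times> real" where
  "real_point = map_prod of_int of_int"

definition sup_dist :: "int \<times> int \<Rightarrow> int \<times> int \<Rightarrow> int" where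
  "sup_dist a b = max \<bar>fst a - fst b\<bar> \<bar>snd a - snd b\<bar>"

definition cross_product :: "int \<times> int \<Rightarrow> int \<times> int \<Rightarrow> int \<times> int \<Rightarrow> int" where
  "cross_product a b c = (fst b - fst a) * (snd c - snd a) - (snd b - snd a) * (fst c - fst a)"

text \<open>The first four disjuncts place the points on three sides of a square whose side length
  is the larger extent, the position of the fourth side being dictated by that length. In the last
  one the bounding box is itself the square.\<close>

definition on_square_boundary :: "(int \<times> int) set \<Rightarrow> bool" where
  "on_square_boundary T \<longleftrightarrow>
     (let a = Min (fst ` T); a' = Max (fst ` T); b = Min (snd ` T); b' = Max (snd ` T) in
        b' - b \<le> a' - a \<and> (\<forall>(x, y)\<in>T. x = a \<or> x = a' \<or> y = b) \<or>
        b' - b \<le> a' - a \<and> (\<forall>(x, y)\<in>T. x = a \<or> x = a' \<or> y = b') \<or>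
        a' - a \<le> b' - b \<and> (\<forall>(x, y)\<in>T. y = b \<or> y = b' \<or> x = a) \<or>
        a' - a \<le> b' - b \<and> (\<forall>(x, y)\<in>T. y = b \<or> y = b' \<or> x = a') \<or>
        a' - a = b' - b \<and> (\<forall>(x, y)\<in>T. x = a \<or> x = a' \<or> y = b \<or> y = b'))"

text \<open>The distance pattern of four equally spaced points, except for
  \<open>sup_dist a b = sup_dist b c\<close>: \<open>crescent_list\<close> tests that equality
  before it ranges over \<open>d\<close>.\<close>

definition equidistant_path ::
  "int \<times> int \<Rightarrow> int \<times> int \<Rightarrow> int \<times> int \<Rightarrow> int \<times> int \<Rightarrow> bool" where
  "equidistant_path a b c d \<longleftrightarrow>
     sup_dist c d = sup_dist a b \<and> sup_dist b d = sup_dist a c \<and> sup_dist a c \<noteq> sup_dist a b \<and>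
     sup_dist a d \<noteq> sup_dist a b \<and> sup_dist a d \<noteq> sup_dist a c"

fun pair_distances :: "(int \<times> int) list \<Rightarrow> int list" where
  "pair_distances [] = []"
| "pair_distances (a # xs) = map (sup_dist a) xs @ pair_distances xs"

text \<open>The conditionals keep the simplifier from evaluating the inner tests.\<close>

definition crescent_list :: "(int \<times> int) list \<Rightarrow> bool" where
  "crescent_list xs \<longleftrightarrow>
     distinct xs \<and>
     (\<forall>a\<in>set xs. \<forall>b\<in>set xs. \<forall>c\<in>set xs.
        if a = b \<or> a = c \<or> b = c then True else cross_product a b c \<noteq> 0) \<and>
     (\<forall>ys\<in>set (subseqs xs). if length ys = 4 then \<not> on_square_boundary (set ys) else True) \<and>
     (\<forall>a\<in>set xs. \<forall>b\<in>set xs. \<forall>c\<in>set xs.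
        if a \<noteq> c \<and> sup_dist a b = sup_dist b c
        then \<forall>d\<in>set xs. \<not> equidistant_path a b c d else True) \<and>
     length (remdups (pair_distances xs)) = length xs - 1 \<and>
     (\<forall>i\<in>set [1..<length xs]. \<exists>d\<in>set (pair_distances xs). count_list (pair_distances xs) d = i)"

section \<open>Norm and collinearity in integer coordinates\<close>

lemma inj_real_point: "inj real_point"
  unfolding real_point_def by (intro prod.inj_map) (auto intro: injI)

lemma real_point_eq_iff [simp]: "real_point a = real_point b \<longleftrightarrow> a = b"
  using inj_real_point by (simp add: inj_eq)

lemma infnorm_real_point: "infnorm (real_point a - real_point b) = of_int (sup_dist a b)"
  by (cases a; cases b) (simp add: real_point_def sup_dist_def infnorm_Pair flip: of_int_diff)

lemma sup_dist_commute: "sup_dist a b = sup_dist b a"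
  by (simp add: sup_dist_def abs_minus_commute)

text \<open>Collinearity makes both differences from \<open>a\<close> multiples of one vector, so
  their determinant vanishes.\<close>

lemma collinear_cross_product:
  assumes "collinear {real_point a, real_point b, real_point c}"
  shows "cross_product a b c = 0"
proof -
  from assms obtain u where u: "\<And>x y. x \<in> {real_point a, real_point b, real_point c} \<Longrightarrow>
      y \<in> {real_point a, real_point b, real_point c} \<Longrightarrow> \<exists>k. x - y = k *\<^sub>R u"
    unfolding collinear_def by blast
  obtain k where k: "real_point b - real_point a = k *\<^sub>R u"
    using u[of "real_point b" "real_point a"] by auto
  obtain l where l: "real_point c - real_point a = l *\<^sub>R u"
    using u[of "real_point c" "real_point a"] by auto
  obtain u1 u2 where "u = (u1, u2)" by (cases u)
  with k l have *: "of_int (fst b - fst a) = k * u1" "of_int (snd b - snd a) = k * u2"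
      "of_int (fst c - fst a) = l * u1" "of_int (snd c - snd a) = l * u2"
    by (auto simp: real_point_def map_prod_def split: prod.splits)
  \<comment> \<open>The instance of \<open>of_int_diff\<close> splits only the outer difference of
    products; the inner coordinate differences stay intact for rewriting with
    \<open>*\<close>.\<close>
  have "real_of_int (cross_product a b c) = 0"
    unfolding cross_product_def of_int_diff[of "_ * _"] of_int_mult * by simp
  then show ?thesis by simp
qed

section \<open>Norm circles and line-like quadruples\<close>

lemma on_square_boundary_if_norm_circle:
  assumes T: "finite T" "T \<noteq> {}" and circle: "real_point ` T \<subseteq> norm_circle infnorm p r"
  shows "on_square_boundary T"
proof -
  obtain p1 p2 where p: "p = (p1, p2)" by (cases p)
  define a a' b b' where ab: "a = Min (fst ` T)" "a' = Max (fst ` T)"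
    "b = Min (snd ` T)" "b' = Max (snd ` T)"
  have on: "max \<bar>of_int x - p1\<bar> \<bar>of_int y - p2\<bar> = r" if "(x, y) \<in> T" for x y
    using circle that
    by (auto simp: norm_circle_def p real_point_def infnorm_Pair image_subset_iff dest: bspec)
  have x: "p1 - r \<le> of_int x" "of_int x \<le> p1 + r" "p2 - r \<le> of_int y" "of_int y \<le> p2 + r"
    and side: "of_int x = p1 - r \<or> of_int x = p1 + r \<or> of_int y = p2 - r \<or> of_int y = p2 + r"
    if "(x, y) \<in> T" for x y
    using on[OF that] by (auto simp: max_def abs_if split: if_splits)
  have mem: "a \<in> fst ` T" "a' \<in> fst ` T" "b \<in> snd ` T" "b' \<in> snd ` T"
    using T by (simp_all add: ab)
  then have box: "p1 - r \<le> of_int a" "of_int a' \<le> p1 + r" "p2 - r \<le> of_int b" "of_int b' \<le> p2 + r"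
    using x by force+
  have le: "a \<le> x" "x \<le> a'" "b \<le> y" "y \<le> b'" if "(x, y) \<in> T" for x y
    using T(1) imageI[OF that, of fst] imageI[OF that, of snd]
    by (simp_all add: ab)
  \<comment> \<open>The square encloses the bounding box, which encloses the point; a point on a
    side therefore pins the corresponding edge of the box to that side.\<close>
  have ext: "of_int x = p1 - r \<Longrightarrow> x = a \<and> of_int a = p1 - r"
       "of_int x = p1 + r \<Longrightarrow> x = a' \<and> of_int a' = p1 + r"
       "of_int y = p2 - r \<Longrightarrow> y = b \<and> of_int b = p2 - r"
       "of_int y = p2 + r \<Longrightarrow> y = b' \<and> of_int b' = p2 + r"
    if "(x, y) \<in> T" for x y
    using le[OF that] box by linarith+
  have cover: "x = a \<and> of_int a = p1 - r \<or> x = a' \<and> of_int a' = p1 + r \<or>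
      y = b \<and> of_int b = p2 - r \<or> y = b' \<and> of_int b' = p2 + r" if "(x, y) \<in> T" for x y
    using side[OF that] ext[OF that] by blast
  consider "real_of_int a = p1 - r" "real_of_int a' = p1 + r"
    | "real_of_int b = p2 - r" "real_of_int b' = p2 + r"
    | "real_of_int a \<noteq> p1 - r \<or> real_of_int a' \<noteq> p1 + r"
      "real_of_int b \<noteq> p2 - r \<or> real_of_int b' \<noteq> p2 + r"
    by blast
  then show ?thesis
  proof cases
    case 1
    with box have "b' - b \<le> a' - a" by linarith
    \<comment> \<open>If both horizontal sides are met too, the box is the whole square and the last
      disjunct applies; otherwise \<open>cover\<close> loses one horizontal side and a three-sided
      disjunct remains.\<close>
    moreover have "a' - a = b' - b" if "real_of_int b = p2 - r" "real_of_int b' = p2 + r"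
      using 1 that by linarith
    ultimately show ?thesis
      using cover unfolding on_square_boundary_def Let_def ab[symmetric] by fast
  next
    case 2
    with box have "a' - a \<le> b' - b" by linarith
    moreover have "a' - a = b' - b" if "real_of_int a = p1 - r" "real_of_int a' = p1 + r"
      using 2 that by linarith
    ultimately show ?thesis
      using cover unfolding on_square_boundary_def Let_def ab[symmetric] by fast
  next
    case 3
    \<comment> \<open>Here \<open>cover\<close> leaves at most one vertical and one horizontal side,
      so a three-sided disjunct fits whichever extent is larger.\<close>
    have "b' - b \<le> a' - a \<or> a' - a \<le> b' - b" by linarith
    with 3 show ?thesis
      using cover unfolding on_square_boundary_def Let_def ab[symmetric] by fast
  qed
qed

text \<open>The preimages of 1, 2, 3, 4 under the bijection form the path: equal gaps give the
  equalities, and the distinct gaps 1, 2, 3 give the inequalities.\<close>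

lemma line_like_four_path:
  assumes "line_like_configuration infnorm 4 (real_point ` T)"
  obtains a b c d where "a \<in> T" "b \<in> T" "c \<in> T" "d \<in> T" "a \<noteq> c"
    "sup_dist a b = sup_dist b c" "equidistant_path a b c d"
proof -
  from assms obtain \<phi> where bij: "bij_betw \<phi> (real_point ` T) {1..4}"
    and dist: "\<And>a b c d. \<lbrakk>a \<in> T; b \<in> T; c \<in> T; d \<in> T\<rbrakk> \<Longrightarrow>
      sup_dist a b = sup_dist c d \<longleftrightarrow>
      \<bar>int (\<phi> (real_point a)) - int (\<phi> (real_point b))\<bar> =
      \<bar>int (\<phi> (real_point c)) - int (\<phi> (real_point d))\<bar>"
    unfolding line_like_configuration_def by (auto simp: infnorm_real_point)
  have ex: "\<exists>a\<in>T. \<phi> (real_point a) = i" if "i \<in> {1..4}" for i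
    using bij_betw_imp_surj_on[OF bij] that by (metis (no_types, lifting) imageE)
  obtain a b c d where mem: "a \<in> T" "b \<in> T" "c \<in> T" "d \<in> T"
    and \<phi>: "\<phi> (real_point a) = 1" "\<phi> (real_point b) = 2" "\<phi> (real_point c) = 3"
      "\<phi> (real_point d) = 4"
    using ex[of 1] ex[of 2] ex[of 3] ex[of 4] by auto
  show thesis
  proof (rule that[OF mem])
    show "a \<noteq> c" using \<phi> by auto
    show "sup_dist a b = sup_dist b c" using mem \<phi> by (simp add: dist)
    show "equidistant_path a b c d" using mem \<phi> by (simp add: equidistant_path_def dist)
  qed
qed

section \<open>Distances and their multiplicities\<close>

lemma distances_real_point:
  assumes "distinct xs"
  shows "distances infnorm (real_point ` set xs) = of_int ` set (pair_distances xs)"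
proof -
  have "distances infnorm (real_point ` set xs) =
      of_int ` {sup_dist a b | a b. a \<in> set xs \<and> b \<in> set xs \<and> a \<noteq> b}"
    (is "?L = ?R")
  proof (intro set_eqI iffI)
    fix e assume "e \<in> ?L"
    then obtain a b where "a \<in> set xs" "b \<in> set xs" "a \<noteq> b"
        "e = infnorm (real_point a - real_point b)"
      unfolding distances_def by blast
    then show "e \<in> ?R" unfolding infnorm_real_point by blast
  next
    fix e assume "e \<in> ?R"
    then obtain a b where ab: "a \<in> set xs" "b \<in> set xs" "a \<noteq> b"
        "e = infnorm (real_point a - real_point b)"
      unfolding infnorm_real_point by blast
    then have "real_point a \<noteq> real_point b" by simp
    with ab show "e \<in> ?L" unfolding distances_def by blast
  qed
  also have "{sup_dist a b | a b. a \<in> set xs \<and> b \<in> set xs \<and> a \<noteq> b} = set (pair_distances xs)"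
    using assms
  proof (induction xs)
    case (Cons a xs)
    then have "set (pair_distances (a # xs)) = sup_dist a ` set xs \<union>
        {sup_dist a b | a b. a \<in> set xs \<and> b \<in> set xs \<and> a \<noteq> b}"
      by simp
    also have "\<dots> = {sup_dist b c | b c. b \<in> set (a # xs) \<and> c \<in> set (a # xs) \<and> b \<noteq> c}"
      (is "?L = ?R")
    proof
      have "a \<noteq> b" if "b \<in> set xs" for b using Cons.prems that by auto
      then show "?L \<subseteq> ?R" unfolding list.set(2) by blast
      \<comment> \<open>The list records each pair from its earlier to its later point; symmetry
        handles \<open>a\<close> in second place.\<close>
      show "?R \<subseteq> ?L" using sup_dist_commute[of _ a] by auto
    qed
    finally show ?case by simp
  qed simp
  finally show ?thesis .
qed

text \<open>Injectivity carries unordered pairs of integer points to unordered pairs of real ones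
  without merging any. In a distinct list each unordered pair contributes exactly one entry to
  \<open>pair_distances\<close>, so counting entries counts pairs.\<close>

lemma multiplicity_real_point:
  assumes "distinct xs"
  shows "multiplicity_of_distance infnorm (real_point ` set xs) (of_int d) =
    count_list (pair_distances xs) d"
proof -
  define P where "P A = {{u, v} | u v. u \<in> A \<and> v \<in> A \<and> u \<noteq> v \<and> sup_dist u v = d}" for A
  have inj: "inj_on real_point A" for A
    using inj_real_point by (rule inj_on_subset) simp
  have "{{u, v} | u v. u \<in> real_point ` set xs \<and> v \<in> real_point ` set xs \<and> u \<noteq> v \<and>
      infnorm (u - v) = of_int d} = (`) real_point ` P (set xs)" (is "?L = ?R")
  proof
    show "?L \<subseteq> ?R"
    proof
      fix e assume "e \<in> ?L"
      then obtain u v where e: "e = real_point ` {u, v}" "u \<in> set xs" "v \<in> set xs" "u \<noteq> v"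
          "infnorm (real_point u - real_point v) = of_int d"
        by blast
      then have "sup_dist u v = d" by (simp add: infnorm_real_point)
      with e show "e \<in> ?R" unfolding P_def by blast
    qed
    show "?R \<subseteq> ?L"
    proof
      fix e assume "e \<in> ?R"
      then obtain u v where e: "e = {real_point u, real_point v}" "u \<in> set xs" "v \<in> set xs"
          "u \<noteq> v" "sup_dist u v = d"
        unfolding P_def by blast
      then have "real_point u \<noteq> real_point v" "infnorm (real_point u - real_point v) = of_int d"
        by (simp_all add: infnorm_real_point)
      with e show "e \<in> ?L" by blast
    qed
  qed
  then have "multiplicity_of_distance infnorm (real_point ` set xs) (of_int d) = card (P (set xs))"
    unfolding multiplicity_of_distance_def
    by (simp add: card_image inj_on_image inj)
  also have "\<dots> = count_list (pair_distances xs) d"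
    using assms
  proof (induction xs)
    case Nil
    then show ?case by (simp add: P_def)
  next
    case (Cons a xs)
    \<comment> \<open>\<open>Q\<close> holds the pairs at distance \<open>d\<close> that contain the
      head. Distinctness separates them from the pairs inside the tail and lets the size of
      \<open>Q\<close> be read off as a count over the tail.\<close>
    define Q where "Q = (\<lambda>b. {a, b}) ` {b \<in> set xs. sup_dist a b = d}"
    have "P (set (a # xs)) = Q \<union> P (set xs)"
    proof
      show "P (set (a # xs)) \<subseteq> Q \<union> P (set xs)"
      proof
        fix e assume "e \<in> P (set (a # xs))"
        then obtain u v where "e = {u, v}" "u \<in> set (a # xs)" "v \<in> set (a # xs)" "u \<noteq> v"
            "sup_dist u v = d"
          unfolding P_def by blast
        moreover from this have "e = {v, u}" "sup_dist v u = d"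
          by (simp_all add: insert_commute sup_dist_commute)
        ultimately show "e \<in> Q \<union> P (set xs)"
          unfolding P_def Q_def list.set(2) by blast
      qed
      show "Q \<union> P (set xs) \<subseteq> P (set (a # xs))"
      proof -
        have "a \<noteq> b" if "b \<in> set xs" for b using Cons.prems that by auto
        then show ?thesis unfolding P_def Q_def list.set(2) by blast
      qed
    qed
    moreover have "Q \<inter> P (set xs) = {}"
      using Cons.prems unfolding P_def Q_def by (auto simp: doubleton_eq_iff)
    moreover have "P (set xs) \<subseteq> Pow (set xs)"
      unfolding P_def by auto
    then have "finite (P (set xs))" by (rule finite_subset) simp
    moreover have "finite Q" unfolding Q_def by simp
    ultimately have "card (P (set (a # xs))) = card Q + card (P (set xs))"
      by (simp add: card_Un_disjoint)
    moreover have "card Q = count_list (map (sup_dist a) xs) d"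
    proof -
      have "card Q = card {b \<in> set xs. sup_dist a b = d}"
        unfolding Q_def by (rule card_image) (auto simp: inj_on_def doubleton_eq_iff)
      also have "\<dots> = length (filter (\<lambda>b. sup_dist a b = d) xs)"
        using Cons.prems by (simp flip: distinct_card)
      also have "\<dots> = count_list (map (sup_dist a) xs) d"
        by (induction xs) auto
      finally show ?thesis .
    qed
    ultimately show ?case
      using Cons by simp
  qed
  finally show ?thesis .
qed

section \<open>From the integer test to configurations\<close>

lemma strong_crescent_configuration_crescent_list:
  assumes "crescent_list xs"
  shows "strong_crescent_configuration infnorm (length xs) (real_point ` set xs)"
proof -
  have dist: "distinct xs"
    and cross: "\<And>a b c. \<lbrakk>a \<in> set xs; b \<in> set xs; c \<in> set xs; a \<noteq> b; a \<noteq> c; b \<noteq> c\<rbrakk> \<Longrightarrow>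
      cross_product a b c \<noteq> 0"
    and square: "\<And>ys. \<lbrakk>ys \<in> set (subseqs xs); length ys = 4\<rbrakk> \<Longrightarrow> \<not> on_square_boundary (set ys)"
    and path: "\<And>a b c d. \<lbrakk>a \<in> set xs; b \<in> set xs; c \<in> set xs; d \<in> set xs; a \<noteq> c;
      sup_dist a b = sup_dist b c\<rbrakk> \<Longrightarrow> \<not> equidistant_path a b c d"
    and len: "length (remdups (pair_distances xs)) = length xs - 1"
    and mult: "\<And>i. \<lbrakk>1 \<le> i; i < length xs\<rbrakk> \<Longrightarrow>
      \<exists>d\<in>set (pair_distances xs). count_list (pair_distances xs) d = i"
    using assms unfolding crescent_list_def by (simp_all split: if_splits)
  have inj: "inj_on real_point A" for A
    using inj_real_point by (rule inj_on_subset) simp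
  have "\<not> collinear T" if T: "T \<subseteq> real_point ` set xs" "card T = 3" for T
  proof
    assume "collinear T"
    from T obtain U where U: "U \<subseteq> set xs" "T = real_point ` U"
      by (auto elim: subset_imageE)
    with T have "card U = 3" by (simp add: card_image[OF inj])
    then obtain a b c where "U = {a, b, c}" "a \<noteq> b" "a \<noteq> c" "b \<noteq> c"
      by (auto simp: card_3_iff)
    with U \<open>collinear T\<close> cross[of a b c] collinear_cross_product[of a b c] show False by simp
  qed
  moreover have "\<not> T \<subseteq> norm_circle infnorm p r"
    if T: "T \<subseteq> real_point ` set xs" "card T = 4" for T p r
  proof
    assume circle: "T \<subseteq> norm_circle infnorm p r"
    from T obtain U where U: "U \<subseteq> set xs" "T = real_point ` U"
      by (auto elim: subset_imageE)
    with T have "card U = 4" by (simp add: card_image[OF inj])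
    \<comment> \<open>Every subset of the points is the set of some subsequence, so testing
      subsequences of length four reaches all four-point subsets.\<close>
    from U(1) obtain ys where ys: "ys \<in> set (subseqs xs)" "U = set ys"
      using subseqs_powset[of xs] by (metis (no_types, lifting) PowI imageE)
    with dist \<open>card U = 4\<close> have "length ys = 4"
      using subseqs_distinctD distinct_card by metis
    with ys square have "\<not> on_square_boundary U" by blast
    moreover have "finite U" "U \<noteq> {}" using \<open>card U = 4\<close> by (auto intro: card_ge_0_finite)
    ultimately show False
      using on_square_boundary_if_norm_circle circle U(2) by blast
  qed
  moreover have "\<not> line_like_configuration infnorm 4 T" if T: "T \<subseteq> real_point ` set xs" for T
  proof
    assume line: "line_like_configuration infnorm 4 T"
    from T obtain U where U: "U \<subseteq> set xs" "T = real_point ` U"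
      by (auto elim: subset_imageE)
    obtain a b c d where "a \<in> U" "b \<in> U" "c \<in> U" "d \<in> U" "a \<noteq> c"
        "sup_dist a b = sup_dist b c" "equidistant_path a b c d"
      using line unfolding U(2) by (rule line_like_four_path)
    with U(1) path[of a b c d] show False by blast
  qed
  ultimately have "strong_general_position infnorm (real_point ` set xs)"
    unfolding strong_general_position_def by blast
  moreover have "card (distances infnorm (real_point ` set xs)) = length xs - 1"
    using len by (simp add: distances_real_point[OF dist] card_image inj_on_def length_remdups_card_conv)
  moreover have "\<exists>d\<in>distances infnorm (real_point ` set xs).
      multiplicity_of_distance infnorm (real_point ` set xs) d = i"
    if i: "1 \<le> i \<and> i \<le> length xs - 1" for i
  proof -
    have "1 \<le> i" "i < length xs" using i by auto
    from mult[OF this] show ?thesis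
      by (auto simp: distances_real_point[OF dist] multiplicity_real_point[OF dist])
  qed
  ultimately show ?thesis
    using dist by (simp add: strong_crescent_configuration_def card_image[OF inj] distinct_card)
qed

text \<open>For a concrete list the test is a finite computation on integers and naturals, decided
  by rewriting with the code equations.\<close>

lemma crescent_list_witnesses:
  "crescent_list [(0, 0)]"
  "crescent_list [(2, 1), (2, 3)]"
  "crescent_list [(1, 1), (2, 3), (2, 1)]"
  "crescent_list [(1, 3), (4, 4), (0, 1), (3, 1)]"
  "crescent_list [(4, 3), (7, 4), (1, 4), (3, 1), (5, 0)]"
  "crescent_list [(3, 5), (0, 1), (2, 4), (6, 7), (0, 7), (4, 3)]"
  "crescent_list [(4, 5), (0, 5), (1, 4), (6, 0), (2, 2), (5, 6), (5, 1)]"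
  "crescent_list [(10, 9), (18, 17), (14, 15), (4, 15), (9, 3), (9, 7), (13, 5), (8, 13)]"
  by code_simp+

theorem theorem1p9:
  fixes n :: nat
  assumes "1 \<le> n" and "n \<le> 8"
  shows "\<exists>S. strong_crescent_configuration infnorm n S"
proof -
  have *: "\<exists>S. strong_crescent_configuration infnorm n S"
    if "crescent_list xs" "length xs = n" for xs
    using strong_crescent_configuration_crescent_list[OF that(1)] that(2) by blast
  from assms have "n = 1 \<or> n = 2 \<or> n = 3 \<or> n = 4 \<or> n = 5 \<or> n = 6 \<or> n = 7 \<or> n = 8"
    by auto
  \<comment> \<open>In each case \<open>rule *\<close> leaves the list schematic; backtracking over
    the witnesses selects the one of length \<open>n\<close>.\<close>
  then show ?thesis
    by (elim disjE) (rule *, rule crescent_list_witnesses, simp)+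
qed

end
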